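(* If $t$ is a closed normal term of star type $\rho^*$ in the star combinatory calculus for arithmetic, then $t$ is set-like and $\mathrm{SM}(t)$ is a finite non-empty set of closed normal terms of type $\rho$.
   Context: Star combinatory calculus for arithmetic: types are generated from the ground type $N$ by $\sigma\to\tau$ and $\sigma^*$. Constants: $0:N$, $S:N\to N$, $R_\sigma:N\to\sigma\to(\sigma\to N\to\sigma)\to\sigma$; $\Pi_{\sigma,\tau}:\sigma\to\tau\to\sigma$; $\Sigma_{\rho,\sigma,\tau}:(\rho\to\sigma\to\tau)\to(\rho\to\sigma)\to\rho\to\tau$; $\mathfrak{s}_\sigma:\sigma\to\sigma^*$; $\cup_\sigma:\sigma^*\to\sigma^*\to\sigma^*$; $\bigcup_{\sigma,\tau}:\sigma^*\to(\sigma\to\tau^* )\to\tau^*$. Terms: constants, typed variables, applications; closed means containing no variables. Conversions: $\Sigma tqr\rightsquigarrow tr(qr)$; $\Pi tq\rightsquigarrow t$; $\bigcup(\mathfrak{s}t)q\rightsquigarrow qt$; $\bigcup(\cup tq)r\rightsquigarrow\cup(\bigcup tr)(\bigcup qr)$; $R0qr\rightsquigarrow q$; $R(St)qr\rightsquigarrow r(Rtqr)t$. A term is normal if no conversion applies to any of its subterms. A term of star type is set-like if it is built from terms of the form $\mathfrak{s}q$ using only the constant $\cup$ (i.e. it is $\mathfrak{s}q$ or $\cup t_1t_2$ with $t_1,t_2$ set-like). For $t$ of type $\sigma^*$, the surface elements $\mathrm{SM}(t)$ are: $\{q\}$ if $t=\mathfrak{s}q$; $\mathrm{SM}(q)\cup\mathrm{SM}(r)$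 if $t=\cup qr$; $\emptyset$ otherwise. *)

theory Defs
  imports Main
begin

datatype ty =
    N
  | Arr ty ty  (infixr "\<rightarrow>" 65)
  | Star ty  ("_\<^sup>\<star>" [1000] 999)

datatype comb =
    Zero
  | Succ
  | Rec ty
  | Pi ty ty
  | Sigma ty ty ty
  | Sing ty
  | Cup ty
  | BigCup ty ty

primrec comb_ty :: "comb \<Rightarrow> ty" where
  "comb_ty Zero = N"
| "comb_ty Succ = N \<rightarrow> N"
| "comb_ty (Rec \<sigma>) = N \<rightarrow> \<sigma> \<rightarrow> (\<sigma> \<rightarrow> N \<rightarrow> \<sigma>) \<rightarrow> \<sigma>"
| "comb_ty (Pi \<sigma> \<tau>) = \<sigma> \<rightarrow> \<tau> \<rightarrow> \<sigma>"
| "comb_ty (Sigma \<rho> \<sigma> \<tau>) = (\<rho> \<rightarrow> \<sigma> \<rightarrow> \<tau>) \<rightarrow> (\<rho> \<rightarrow> \<sigma>) \<rightarrow> \<rho> \<rightarrow> \<tau>"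
| "comb_ty (Sing \<sigma>) = \<sigma> \<rightarrow> \<sigma>\<^sup>\<star>"
| "comb_ty (Cup \<sigma>) = \<sigma>\<^sup>\<star> \<rightarrow> \<sigma>\<^sup>\<star> \<rightarrow> \<sigma>\<^sup>\<star>"
| "comb_ty (BigCup \<sigma> \<tau>) = \<sigma>\<^sup>\<star> \<rightarrow> (\<sigma> \<rightarrow> \<tau>\<^sup>\<star>) \<rightarrow> \<tau>\<^sup>\<star>"

text \<open>
  Raw application trees, in which variables carry their type (Church style). The terms of type
  \<open>\<sigma>\<close> of the calculus are the raw terms \<open>t\<close> with \<open>has_type t \<sigma>\<close>.
\<close>

datatype trm =
    Var nat ty
  | Con comb
  | App trm trm  (infixl "\<cdot>" 100)

inductive has_type :: "trm \<Rightarrow> ty \<Rightarrow> bool" where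
  "has_type (Var x \<sigma>) \<sigma>"
| "has_type (Con c) (comb_ty c)"
| "has_type t (\<sigma> \<rightarrow> \<tau>) \<Longrightarrow> has_type q \<sigma> \<Longrightarrow> has_type (t \<cdot> q) \<tau>"

primrec vars :: "trm \<Rightarrow> (nat \<times> ty) set" where
  "vars (Var x \<sigma>) = {(x, \<sigma>)}"
| "vars (Con c) = {}"
| "vars (t \<cdot> q) = vars t \<union> vars q"

definition closed_trm :: "trm \<Rightarrow> bool" where
  "closed_trm t \<longleftrightarrow> vars t = {}"

primrec subterms :: "trm \<Rightarrow> trm set" where
  "subterms (Var x \<sigma>) = {Var x \<sigma>}"
| "subterms (Con c) = {Con c}"
| "subterms (t \<cdot> q) = {t \<cdot> q} \<union> subterms t \<union> subterms q"

text \<open>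
  The repeated type indices on the left-hand sides are no restriction: they coincide in every
  well-typed term of the given shape.
\<close>

inductive conv :: "trm \<Rightarrow> trm \<Rightarrow> bool"  (infix "\<leadsto>" 50) where
  "Con (Sigma \<rho> \<sigma> \<tau>) \<cdot> t \<cdot> q \<cdot> r \<leadsto> t \<cdot> r \<cdot> (q \<cdot> r)"
| "Con (Pi \<sigma> \<tau>) \<cdot> t \<cdot> q \<leadsto> t"
| "Con (BigCup \<sigma> \<tau>) \<cdot> (Con (Sing \<sigma>) \<cdot> t) \<cdot> q \<leadsto> q \<cdot> t"
| "Con (BigCup \<sigma> \<tau>) \<cdot> (Con (Cup \<sigma>) \<cdot> t \<cdot> q) \<cdot> r \<leadsto>
     Con (Cup \<tau>) \<cdot> (Con (BigCup \<sigma> \<tau>) \<cdot> t \<cdot> r) \<cdot> (Con (BigCup \<sigma> \<tau>) \<cdot> q \<cdot> r)"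
| "Con (Rec \<sigma>) \<cdot> Con Zero \<cdot> q \<cdot> r \<leadsto> q"
| "Con (Rec \<sigma>) \<cdot> (Con Succ \<cdot> t) \<cdot> q \<cdot> r \<leadsto> r \<cdot> (Con (Rec \<sigma>) \<cdot> t \<cdot> q \<cdot> r) \<cdot> t"

definition normal :: "trm \<Rightarrow> bool" where
  "normal t \<longleftrightarrow> (\<forall>s \<in> subterms t. \<not> (\<exists>u. s \<leadsto> u))"

inductive set_like :: "trm \<Rightarrow> bool" where
  "has_type q \<sigma> \<Longrightarrow> set_like (Con (Sing \<sigma>) \<cdot> q)"
| "set_like t\<^sub>1 \<Longrightarrow> set_like t\<^sub>2 \<Longrightarrow> has_type t\<^sub>1 (\<sigma>\<^sup>\<star>) \<Longrightarrow> has_type t\<^sub>2 (\<sigma>\<^sup>\<star>) \<Longrightarrow>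
   set_like (Con (Cup \<sigma>) \<cdot> t\<^sub>1 \<cdot> t\<^sub>2)"

fun SM :: "trm \<Rightarrow> trm set" where
  "SM (Con (Sing \<sigma>) \<cdot> q) = {q}"
| "SM (Con (Cup \<sigma>) \<cdot> q \<cdot> r) = SM q \<union> SM r"
| "SM _ = {}"

end

(* Call a closed term canonical if every constant in it receives too few arguments for a conversion, or is
   S, the singleton constant or the binary union with at most all its arguments. A closed normal
   term is canonical by induction on its structure: if R had three arguments or the big union two,
   the first of them would be a canonical term of type N or of star type, hence headed by 0 or S, or
   equal to a singleton or a binary union, and the whole would be a redex. The only canonical terms
   of star type are the set-like ones. *)
theory Submission
  imports Defs
begin

lemma has_type_Con_iff [simp]: "has_type (Con c) \<sigma> \<longleftrightarrow> \<sigma> = comb_ty c"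
  by (subst has_type.simps) auto

lemma has_type_App_iff [simp]:
  "has_type (t \<cdot> q) \<tau> \<longleftrightarrow> (\<exists>\<sigma>. has_type t (\<sigma> \<rightarrow> \<tau>) \<and> has_type q \<sigma>)"
  by (subst has_type.simps) auto

lemma closed_trm_Var [simp]: "\<not> closed_trm (Var x \<sigma>)"
  by (simp add: closed_trm_def)

lemma closed_trm_App [simp]: "closed_trm (t \<cdot> q) \<longleftrightarrow> closed_trm t \<and> closed_trm q"
  by (simp add: closed_trm_def)

lemma normal_App: "normal (t \<cdot> q) \<longleftrightarrow> (\<nexists>u. t \<cdot> q \<leadsto> u) \<and> normal t \<and> normal q"
  by (auto simp: normal_def)

lemma finite_SM: "finite (SM t)"
  by (induction t rule: SM.induct) auto

lemma has_type_SM: "q \<in> SM t \<Longrightarrow> has_type t (\<sigma>\<^sup>\<star>) \<Longrightarrow> has_type q \<sigma>"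
  by (induction t rule: SM.induct) auto

lemma closed_trm_SM: "q \<in> SM t \<Longrightarrow> closed_trm t \<Longrightarrow> closed_trm q"
  by (induction t rule: SM.induct) auto

lemma normal_SM: "q \<in> SM t \<Longrightarrow> normal t \<Longrightarrow> normal q"
  by (induction t rule: SM.induct) (auto simp: normal_App)

lemma set_like_SM_nonempty: "set_like t \<Longrightarrow> SM t \<noteq> {}"
  by (induction rule: set_like.induct) auto

inductive canonical :: "trm \<Rightarrow> bool" where
  Con: "canonical (Con c)"
| Succ: "canonical t \<Longrightarrow> canonical (Con Succ \<cdot> t)"
| Rec1: "canonical t \<Longrightarrow> canonical (Con (Rec \<sigma>) \<cdot> t)"
| Rec2: "canonical t \<Longrightarrow> canonical q \<Longrightarrow> canonical (Con (Rec \<sigma>) \<cdot> t \<cdot> q)"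
| Pi1: "canonical t \<Longrightarrow> canonical (Con (Pi \<sigma> \<tau>) \<cdot> t)"
| Sigma1: "canonical t \<Longrightarrow> canonical (Con (Sigma \<rho> \<sigma> \<tau>) \<cdot> t)"
| Sigma2: "canonical t \<Longrightarrow> canonical q \<Longrightarrow> canonical (Con (Sigma \<rho> \<sigma> \<tau>) \<cdot> t \<cdot> q)"
| Sing: "canonical t \<Longrightarrow> canonical (Con (Sing \<sigma>) \<cdot> t)"
| Cup1: "canonical t \<Longrightarrow> canonical (Con (Cup \<sigma>) \<cdot> t)"
| Cup2: "canonical t \<Longrightarrow> canonical q \<Longrightarrow> canonical (Con (Cup \<sigma>) \<cdot> t \<cdot> q)"
| BigCup1: "canonical t \<Longrightarrow> canonical (Con (BigCup \<sigma> \<tau>) \<cdot> t)"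

lemma N_eq_comb_ty_iff [simp]: "N = comb_ty c \<longleftrightarrow> c = Zero"
  by (cases c) auto

lemma Star_neq_comb_ty [simp]: "\<sigma>\<^sup>\<star> \<noteq> comb_ty c"
  by (cases c) auto

lemma canonical_N_cases:
  assumes "canonical t" "has_type t N"
  obtains (Zero) "t = Con Zero" | (Succ) q where "t = Con Succ \<cdot> q"
  using assms by (cases rule: canonical.cases) auto

lemma canonical_Star_cases:
  assumes "canonical t" "has_type t (\<sigma>\<^sup>\<star>)"
  obtains (Sing) q where "t = Con (Sing \<sigma>) \<cdot> q"
    | (Cup) q r where "t = Con (Cup \<sigma>) \<cdot> q \<cdot> r"
  using assms by (cases rule: canonical.cases) auto

lemma Rec_canonical_reducible:
  assumes "canonical t" "has_type t N"
  shows "\<exists>u. Con (Rec \<sigma>) \<cdot> t \<cdot> q \<cdot> r \<leadsto> u"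
  using assms by (cases rule: canonical_N_cases) (auto intro: conv.intros)

lemma BigCup_canonical_reducible:
  assumes "canonical t" "has_type t (\<sigma>\<^sup>\<star>)"
  shows "\<exists>u. Con (BigCup \<sigma> \<tau>) \<cdot> t \<cdot> q \<leadsto> u"
  using assms by (cases rule: canonical_Star_cases) (auto intro: conv.intros)

lemma canonical_Con_App:
  assumes "has_type (Con c \<cdot> q) \<tau>" "canonical q"
  shows "canonical (Con c \<cdot> q)"
  using assms by (cases c) (auto intro: canonical.intros)

lemma canonical_App:
  assumes "canonical t" "canonical q" "has_type (t \<cdot> q) \<tau>"
    and irreducible: "\<nexists>u. t \<cdot> q \<leadsto> u"
  shows "canonical (t \<cdot> q)"
  using assms(1)
proof (cases rule: canonical.cases)
  case Con
  with assms show ?thesis using canonical_Con_App by blast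
next
  case (Rec2 n s \<sigma>)
  with assms(3) have "has_type n N" by simp
  with Rec2 irreducible show ?thesis using Rec_canonical_reducible by blast
next
  case Pi1
  with irreducible show ?thesis by (blast intro: conv.intros)
next
  case Sigma2
  with irreducible show ?thesis by (blast intro: conv.intros)
next
  case (BigCup1 s \<sigma> \<sigma>')
  with assms(3) have "has_type s (\<sigma>\<^sup>\<star>)" by simp
  with BigCup1 irreducible show ?thesis using BigCup_canonical_reducible by blast
qed (use assms in \<open>auto intro: canonical.intros\<close>)

lemma closed_normal_canonical:
  assumes "has_type t \<sigma>" "closed_trm t" "normal t"
  shows "canonical t"
  using assms
proof (induction t arbitrary: \<sigma>)
  case (Var x \<tau>)
  then show ?case by simp
next
  case (Con c)
  show ?case by (rule canonical.Con)
next
  case (App t q)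
  then have "canonical t" "canonical q" "\<nexists>u. t \<cdot> q \<leadsto> u"
    by (auto simp: normal_App)
  with App.prems(1) show ?case by (intro canonical_App)
qed

lemma canonical_Star_set_like:
  assumes "canonical t" "has_type t (\<sigma>\<^sup>\<star>)"
  shows "set_like t"
  using assms by (induction t) (auto intro: set_like.intros)

theorem theorem11:
  fixes t :: trm and \<rho> :: ty
  assumes "has_type t (\<rho>\<^sup>\<star>)"
    and "closed_trm t"
    and "normal t"
  shows "set_like t \<and> finite (SM t) \<and> SM t \<noteq> {} \<and>
         (\<forall>q \<in> SM t. has_type q \<rho> \<and> closed_trm q \<and> normal q)"
proof -
  have "canonical t"
    using assms by (rule closed_normal_canonical)
  then have "set_like t"
    using assms(1) by (rule canonical_Star_set_like)
  moreover have "has_type q \<rho> \<and> closed_trm q \<and> normal q" if "q \<in> SM t" for q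
    using that assms has_type_SM closed_trm_SM normal_SM by blast
  ultimately show ?thesis
    using finite_SM set_like_SM_nonempty by blast
qed

end
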